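(* Let $A$ be a finite set with at least two elements and let $(B;+)$ be an abelian group whose exponent is not a power of $2$ (the exponent may be infinite). Then for each integer $n \ge 1$ there exists a function $f \colon A^n \to B$ determined by $\operatorname{oddsupp}$ that is not decomposable.
   Context: For a tuple $(a_1,\dots,a_m) \in A^m$, $\operatorname{oddsupp}(a_1,\dots,a_m) = \{a \in A : |\{j : a_j = a\}| \text{ is odd}\}$. A function $f \colon A^n \to B$ is determined by $\operatorname{oddsupp}$ if there is a map $\varphi \colon \mathcal{P}(A) \to B$ with $f(\mathbf{x}) = \varphi(\operatorname{oddsupp}(\mathbf{x}))$ for all $\mathbf{x} \in A^n$. The essential arity of $g \colon A^n \to B$ is the number of variables $i$ for which there exist tuples differing only in the $i$-th coordinate on which $g$ takes different values. $f \colon A^n \to B$ is $k$-decomposable if $f = f_1 + \dots + f_s$ with each $f_j \colon A^n \to B$ of essential arity at most $k$, and decomposable if it is $(n-1)$-decomposable. The exponent of $B$ is the least common multiple of the orders of its elements if these orders are bounded, and $\infty$ otherwise (in which case it is not a power of $2$). *)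

theory Defs
  imports "HOL-Algebra.Multiplicative_Group" "HOL-Library.Extended_Nat"
begin

text \<open>
  Abelian groups are HOL-Algebra commutative groups, hence written multiplicatively:
  the sum of group elements is \<open>finprod\<close>.
\<close>

definition tuples :: "'a set \<Rightarrow> nat \<Rightarrow> (nat \<Rightarrow> 'a) set" where
  "tuples A n = ({..<n} \<rightarrow>\<^sub>E A)"

definition oddsupp :: "'a set \<Rightarrow> nat \<Rightarrow> (nat \<Rightarrow> 'a) \<Rightarrow> 'a set" where
  "oddsupp A n x = {a \<in> A. odd (card {j \<in> {..<n}. x j = a})}"

definition determined_by_oddsupp ::
    "'a set \<Rightarrow> nat \<Rightarrow> ('b, 'c) monoid_scheme \<Rightarrow> ((nat \<Rightarrow> 'a) \<Rightarrow> 'b) \<Rightarrow> bool" where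
  "determined_by_oddsupp A n B f \<longleftrightarrow>
     (\<exists>\<phi> \<in> Pow A \<rightarrow> carrier B. \<forall>x \<in> tuples A n. f x = \<phi> (oddsupp A n x))"

definition essential_arity :: "'a set \<Rightarrow> nat \<Rightarrow> ((nat \<Rightarrow> 'a) \<Rightarrow> 'b) \<Rightarrow> nat" where
  "essential_arity A n g =
     card {i \<in> {..<n}. \<exists>x \<in> tuples A n. \<exists>y \<in> tuples A n.
                         (\<forall>j \<in> {..<n} - {i}. x j = y j) \<and> g x \<noteq> g y}"

definition k_decomposable ::
    "'a set \<Rightarrow> nat \<Rightarrow> ('b, 'c) monoid_scheme \<Rightarrow> nat \<Rightarrow> ((nat \<Rightarrow> 'a) \<Rightarrow> 'b) \<Rightarrow> bool" where
  "k_decomposable A n B k f \<longleftrightarrow>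
     (\<exists>(s :: nat) F.
        (\<forall>j < s. F j \<in> tuples A n \<rightarrow> carrier B \<and> essential_arity A n (F j) \<le> k) \<and>
        (\<forall>x \<in> tuples A n. f x = finprod B (\<lambda>j. F j x) {..<s}))"

text \<open>Only meaningful for \<open>n \<ge> 1\<close>, because of truncated subtraction.\<close>

definition decomposable ::
    "'a set \<Rightarrow> nat \<Rightarrow> ('b, 'c) monoid_scheme \<Rightarrow> ((nat \<Rightarrow> 'a) \<Rightarrow> 'b) \<Rightarrow> bool" where
  "decomposable A n B f \<longleftrightarrow> k_decomposable A n B (n - 1) f"

text \<open>
  \<open>group.ord\<close> is \<open>0\<close> on elements of infinite order, so boundedness of the orders has to
  demand that they are positive.
\<close>

definition group_exponent :: "('b, 'c) monoid_scheme \<Rightarrow> enat" where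
  "group_exponent B =
     (if \<exists>N. \<forall>b \<in> carrier B. 0 < group.ord B b \<and> group.ord B b \<le> N
      then enat (Lcm (group.ord B ` carrier B)) else \<infinity>)"

end

theory Submission
  imports Defs "HOL-Computational_Algebra.Primes"
begin

text \<open>
  Fix \<open>a \<noteq> c\<close> in \<open>A\<close>. A function that ignores some coordinate \<open>i\<close> has equal sums over the two
  parity classes of tuples in \<open>{a, c}\<^sup>n\<close>, because exchanging \<open>a\<close> and \<open>c\<close> at \<open>i\<close> is a bijection
  between these classes. Hence so does every decomposable function. The function with value \<open>b\<close>
  where \<open>a\<close> lies in the odd support and \<open>0\<close> elsewhere has sums \<open>2\<^bsup>n-1\<^esup> b\<close> and \<open>0\<close>, and if the exponent
  of the group is not a power of \<open>2\<close>, then \<open>b\<close> can be chosen with \<open>2\<^bsup>n-1\<^esup> b \<noteq> 0\<close>.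
\<close>

text \<open>With only the two values \<open>a\<close> and \<open>c\<close> allowed, \<open>p\<close>
  records whether \<open>a\<close> lies in the odd support. A Boolean index lets
  \<open>\<not> p\<close> name the opposite class, so one lemma covers both directions.\<close>

definition parity_class :: "'a \<Rightarrow> 'a \<Rightarrow> nat \<Rightarrow> bool \<Rightarrow> (nat \<Rightarrow> 'a) set" where
  "parity_class a c n p = {x \<in> tuples {a, c} n. odd (card {j \<in> {..<n}. x j = a}) = p}"

definition swap_at :: "'a \<Rightarrow> 'a \<Rightarrow> nat \<Rightarrow> (nat \<Rightarrow> 'a) \<Rightarrow> nat \<Rightarrow> 'a" where
  "swap_at a c i x = x(i := if x i = a then c else a)"

lemma finite_tuples: "finite A \<Longrightarrow> finite (tuples A n)"
  by (simp add: tuples_def finite_PiE)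

lemma tuples_mono: "A \<subseteq> A' \<Longrightarrow> tuples A n \<subseteq> tuples A' n"
  unfolding tuples_def by (rule PiE_mono) auto

lemma finite_parity_class: "finite (parity_class a c n p)"
  by (simp add: parity_class_def finite_tuples)

lemma swap_at_swap_at:
  assumes "x \<in> tuples {a, c} n" "i < n"
  shows "swap_at a c i (swap_at a c i x) = x"
proof -
  have "x i = a \<or> x i = c" using assms by (auto simp: tuples_def PiE_iff)
  then show ?thesis by (auto simp: swap_at_def)
qed

text \<open>Exchanging the value at \<open>i\<close> removes \<open>i\<close> from the set of
  positions holding \<open>a\<close> or adds it, so the size of that set changes by exactly
  one.\<close>

lemma swap_at_parity_class:
  assumes "a \<noteq> c" "i < n" "x \<in> parity_class a c n p"
  shows "swap_at a c i x \<in> parity_class a c n (\<not> p)"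
proof -
  let ?S = "{j \<in> {..<n}. x j = a}"
  have tup: "swap_at a c i x \<in> tuples {a, c} n"
    using assms by (auto simp: parity_class_def swap_at_def tuples_def PiE_iff extensional_def)
  have "odd (card {j \<in> {..<n}. swap_at a c i x j = a}) \<longleftrightarrow> even (card ?S)"
  proof (cases "x i = a")
    case True
    have "{j \<in> {..<n}. swap_at a c i x j = a} = ?S - {i}"
      using True assms(1) by (auto simp: swap_at_def)
    moreover have "card ?S = Suc (card (?S - {i}))"
      using True assms(2) by (intro card_Suc_Diff1[symmetric]) auto
    ultimately show ?thesis by (simp only: even_Suc not_not)
  next
    case False
    have "{j \<in> {..<n}. swap_at a c i x j = a} = insert i ?S"
      using False assms(2) by (auto simp: swap_at_def)
    then show ?thesis using False by simp
  qed
  then show ?thesis using assms(3) tup by (auto simp: parity_class_def)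
qed

lemma bij_betw_swap_at:
  assumes "a \<noteq> c" "i < n"
  shows "bij_betw (swap_at a c i) (parity_class a c n p) (parity_class a c n (\<not> p))"
proof (rule bij_betw_byWitness[where f' = "swap_at a c i"])
  show "\<forall>x \<in> parity_class a c n p. swap_at a c i (swap_at a c i x) = x"
    and "\<forall>x \<in> parity_class a c n (\<not> p). swap_at a c i (swap_at a c i x) = x"
    using assms(2) by (auto simp: parity_class_def intro!: swap_at_swap_at)
  show "swap_at a c i ` parity_class a c n p \<subseteq> parity_class a c n (\<not> p)"
    and "swap_at a c i ` parity_class a c n (\<not> p) \<subseteq> parity_class a c n p"
    using swap_at_parity_class[OF assms, of _ p] swap_at_parity_class[OF assms, of _ "\<not> p"]
    by auto
qed

lemma card_parity_class:
  assumes "a \<noteq> c" "n \<ge> 1"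
  shows "card (parity_class a c n p) = 2 ^ (n - 1)"
proof -
  \<comment> \<open>Since \<open>n \<ge> 1\<close>, coordinate 0 exists, and swapping there matches
    the two classes. They split the \<open>2 ^ n\<close> tuples evenly.\<close>
  have eq: "card (parity_class a c n p) = card (parity_class a c n (\<not> p))"
    using bij_betw_same_card[OF bij_betw_swap_at] assms by (metis zero_less_one order_less_le_trans)
  have "tuples {a, c} n = parity_class a c n p \<union> parity_class a c n (\<not> p)"
    by (auto simp: parity_class_def)
  then have "card (tuples {a, c} n)
      = card (parity_class a c n p) + card (parity_class a c n (\<not> p))"
    by (simp only:) (rule card_Un_disjoint, auto simp: parity_class_def finite_tuples)
  moreover have "card (tuples {a, c} n) = 2 ^ n"
    using assms(1) by (simp add: tuples_def card_PiE numeral_2_eq_2)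
  moreover have "(2::nat) ^ n = 2 * 2 ^ (n - 1)"
    using assms(2) by (simp flip: power_Suc)
  ultimately show ?thesis using eq by linarith
qed

text \<open>Counting: fewer than \<open>n\<close> essential coordinates cannot exhaust
  \<open>{..<n}\<close>.\<close>

lemma essential_arity_less_imp_inessential:
  assumes "essential_arity A n g < n"
  obtains i where "i < n"
    and "\<And>x y. x \<in> tuples A n \<Longrightarrow> y \<in> tuples A n \<Longrightarrow> (\<forall>j \<in> {..<n} - {i}. x j = y j) \<Longrightarrow> g x = g y"
proof -
  let ?E = "{i \<in> {..<n}. \<exists>x \<in> tuples A n. \<exists>y \<in> tuples A n.
              (\<forall>j \<in> {..<n} - {i}. x j = y j) \<and> g x \<noteq> g y}"
  have "?E \<noteq> {..<n}"
    using assms unfolding essential_arity_def by (metis (no_types, lifting) card_lessThan less_irrefl)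
  then obtain i where "i < n" "i \<notin> ?E" by blast
  then show ?thesis by (intro that[of i]) auto
qed

lemma finprod_parity_class_inessential:
  assumes "comm_group B" "a \<in> A" "c \<in> A" "a \<noteq> c"
    and g: "g \<in> tuples A n \<rightarrow> carrier B" "essential_arity A n g < n"
  shows "finprod B g (parity_class a c n p) = finprod B g (parity_class a c n (\<not> p))"
proof -
  interpret comm_group B by fact
  obtain i where i: "i < n"
    and g_eq: "\<And>x y. x \<in> tuples A n \<Longrightarrow> y \<in> tuples A n \<Longrightarrow>
                 (\<forall>j \<in> {..<n} - {i}. x j = y j) \<Longrightarrow> g x = g y"
    using essential_arity_less_imp_inessential[OF g(2)] by blast
  have sub: "parity_class a c n q \<subseteq> tuples A n" for q
    using tuples_mono[of "{a, c}" A n] assms(2,3) by (auto simp: parity_class_def)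
  note bij = bij_betw_swap_at[OF assms(4) i, of p]
  have "finprod B g (parity_class a c n (\<not> p))
      = finprod B g (swap_at a c i ` parity_class a c n p)"
    using bij by (simp add: bij_betw_def)
  \<comment> \<open>Reindexing needs injectivity of the swap on the class, and values of
    \<open>g\<close> in the carrier on its image.\<close>
  also have "\<dots> = finprod B (\<lambda>x. g (swap_at a c i x)) (parity_class a c n p)"
    using bij g(1) sub by (intro finprod_reindex) (auto simp: bij_betw_def)
  also have "\<dots> = finprod B g (parity_class a c n p)"
  proof (rule finprod_cong')
    fix x assume "x \<in> parity_class a c n p"
    then have "swap_at a c i x \<in> tuples A n" "x \<in> tuples A n"
      using swap_at_parity_class[OF assms(4) i] sub by blast+
    then show "g (swap_at a c i x) = g x"
      \<comment> \<open>The swap alters coordinate \<open>i\<close> only, and \<open>g\<close>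
        ignores it.\<close>
      by (rule g_eq) (simp add: swap_at_def)
  qed (use g(1) sub in auto)
  finally show ?thesis by simp
qed

text \<open>The property of having equal sums over both classes is closed under addition, so it
  passes from the summands of low essential arity to \<open>f\<close>.\<close>

lemma finprod_parity_class_decomposable:
  assumes "comm_group B" "a \<in> A" "c \<in> A" "a \<noteq> c" "n \<ge> 1" "decomposable A n B f"
  shows "finprod B f (parity_class a c n p) = finprod B f (parity_class a c n (\<not> p))"
proof -
  interpret comm_group B by fact
  obtain s :: nat and F where
    F: "\<And>j. j < s \<Longrightarrow> F j \<in> tuples A n \<rightarrow> carrier B"
       "\<And>j. j < s \<Longrightarrow> essential_arity A n (F j) \<le> n - 1"
    and f: "\<And>x. x \<in> tuples A n \<Longrightarrow> f x = finprod B (\<lambda>j. F j x) {..<s}"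
    using assms(6) unfolding decomposable_def k_decomposable_def by blast
  have sub: "parity_class a c n q \<subseteq> tuples A n" for q
    using tuples_mono[of "{a, c}" A n] assms(2,3) by (auto simp: parity_class_def)
  \<comment> \<open>Induction on the number of summands; the guard \<open>t \<le> s\<close> is there
    because \<open>F j\<close> is controlled only for \<open>j < s\<close>.\<close>
  have partial: "t \<le> s \<Longrightarrow>
      finprod B (\<lambda>x. finprod B (\<lambda>j. F j x) {..<t}) (parity_class a c n p)
    = finprod B (\<lambda>x. finprod B (\<lambda>j. F j x) {..<t}) (parity_class a c n (\<not> p))" for t
  proof (induction t)
    case 0
    show ?case by simp
  next
    case (Suc t)
    have split: "finprod B (\<lambda>x. finprod B (\<lambda>j. F j x) {..<Suc t}) (parity_class a c n q)
       = finprod B (F t) (parity_class a c n q)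
         \<otimes>\<^bsub>B\<^esub> finprod B (\<lambda>x. finprod B (\<lambda>j. F j x) {..<t}) (parity_class a c n q)" for q
    proof -
      have mem: "F j x \<in> carrier B" if "j < Suc t" "x \<in> parity_class a c n q" for j x
        using F(1)[of j] that Suc.prems sub by auto
      have "finprod B (\<lambda>x. finprod B (\<lambda>j. F j x) {..<Suc t}) (parity_class a c n q)
          = finprod B (\<lambda>x. F t x \<otimes>\<^bsub>B\<^esub> finprod B (\<lambda>j. F j x) {..<t}) (parity_class a c n q)"
        using mem by (intro finprod_cong') (auto simp: lessThan_Suc intro!: finprod_closed)
      also have "\<dots> = finprod B (F t) (parity_class a c n q)
         \<otimes>\<^bsub>B\<^esub> finprod B (\<lambda>x. finprod B (\<lambda>j. F j x) {..<t}) (parity_class a c n q)"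
        using mem by (intro finprod_multf) (auto intro!: finprod_closed)
      finally show ?thesis .
    qed
    \<comment> \<open>Here \<open>n \<ge> 1\<close> rules out truncation in
      \<open>n - 1\<close>.\<close>
    have "essential_arity A n (F t) < n"
      using F(2)[of t] Suc.prems assms(5) by linarith
    then have "finprod B (F t) (parity_class a c n p) = finprod B (F t) (parity_class a c n (\<not> p))"
      using Suc.prems by (intro finprod_parity_class_inessential[OF assms(1-4)] F(1)) auto
    then show ?case using Suc split by simp
  qed
  have "finprod B f (parity_class a c n q)
      = finprod B (\<lambda>x. finprod B (\<lambda>j. F j x) {..<s}) (parity_class a c n q)" for q
    using F(1) f sub by (intro finprod_cong') (fastforce intro!: finprod_closed)+
  then show ?thesis using partial[of s] by simp
qed

text \<open>Every order divides \<open>2 ^ m\<close>. This makes the orders positive and bounded, so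
  the exponent is the finite \<open>Lcm\<close>, itself a divisor of \<open>2 ^ m\<close>. The
  contrapositive supplies the element \<open>b\<close> of the main proof.\<close>

lemma group_exponent_eq_power_of_2:
  assumes "group B" "\<And>b. b \<in> carrier B \<Longrightarrow> b [^]\<^bsub>B\<^esub> (2 ^ m :: nat) = \<one>\<^bsub>B\<^esub>"
  shows "\<exists>k. group_exponent B = enat (2 ^ k)"
proof -
  interpret group B by fact
  have dvd: "ord b dvd 2 ^ m" if "b \<in> carrier B" for b
    using assms(2)[OF that] pow_eq_id[OF that] by blast
  have "\<exists>N. \<forall>b \<in> carrier B. 0 < ord b \<and> ord b \<le> N"
    using dvd by (intro exI[of _ "2 ^ m"]) (auto intro: dvd_imp_le dvd_pos_nat[of "2 ^ m"])
  then have "group_exponent B = enat (Lcm (ord ` carrier B))"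
    by (simp add: group_exponent_def)
  moreover have "Lcm (ord ` carrier B) dvd 2 ^ m"
    using dvd by (auto intro: Lcm_least)
  then obtain k where "Lcm (ord ` carrier B) = 2 ^ k"
    using divides_primepow_nat[OF two_is_prime_nat] by blast
  ultimately show ?thesis by auto
qed

theorem theorem3p6:
  fixes A :: "'a set" and B :: "('b, 'c) monoid_scheme"
  assumes "finite A" and "card A \<ge> 2"
    and "comm_group B"
    and "\<forall>k :: nat. group_exponent B \<noteq> enat (2 ^ k)"
  shows "\<forall>n :: nat. n \<ge> 1 \<longrightarrow>
           (\<exists>f \<in> tuples A n \<rightarrow> carrier B.
              determined_by_oddsupp A n B f \<and> \<not> decomposable A n B f)"
proof (intro allI impI)
  fix n :: nat
  assume n: "n \<ge> 1"
  interpret comm_group B by fact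
  obtain a c where ac: "a \<in> A" "c \<in> A" "a \<noteq> c"
    using assms(2) by (metis One_nat_def Suc_1 card_le_Suc0_iff_eq assms(1) not_less_eq_eq)
  \<comment> \<open>If \<open>2 ^ (n - 1)\<close> annihilated every element, the exponent would be a
    power of 2. This number is the size of a parity class, so \<open>b\<close> summed over a class
    does not vanish.\<close>
  obtain b where b: "b \<in> carrier B" "b [^]\<^bsub>B\<^esub> (2 ^ (n - 1) :: nat) \<noteq> \<one>\<^bsub>B\<^esub>"
    using group_exponent_eq_power_of_2[OF is_group] assms(4) by blast
  define \<phi> where "\<phi> S = (if a \<in> S then b else \<one>\<^bsub>B\<^esub>)" for S
  define f where "f x = \<phi> (oddsupp A n x)" for x
  \<comment> \<open>On a parity class \<open>f\<close> is constant, since there \<open>p\<close>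
    decides whether \<open>a\<close> is in the odd support.\<close>
  have f_class: "f x = (if p then b else \<one>\<^bsub>B\<^esub>)" if "x \<in> parity_class a c n p" for x p
    using that ac(1) by (auto simp: f_def \<phi>_def oddsupp_def parity_class_def)
  have "finprod B f (parity_class a c n True) = finprod B (\<lambda>_. b) (parity_class a c n True)"
    using f_class b(1) by (intro finprod_cong') auto
  also have "\<dots> = b [^]\<^bsub>B\<^esub> (2 ^ (n - 1) :: nat)"
    using b(1) finprod_const[of b "parity_class a c n True"] card_parity_class[OF ac(3) n] by simp
  finally have odd: "finprod B f (parity_class a c n True) \<noteq> \<one>\<^bsub>B\<^esub>"
    using b(2) by simp
  have even: "finprod B f (parity_class a c n False) = \<one>\<^bsub>B\<^esub>"
    using f_class by (intro finprod_one_eqI) auto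
  have "\<not> decomposable A n B f"
    using finprod_parity_class_decomposable[OF assms(3) ac n, of f True] odd even by auto
  moreover have "determined_by_oddsupp A n B f"
    unfolding determined_by_oddsupp_def using b(1)
    by (intro bexI[of _ \<phi>]) (auto simp: f_def \<phi>_def)
  moreover have "f \<in> tuples A n \<rightarrow> carrier B"
    using b(1) by (auto simp: f_def \<phi>_def)
  ultimately show "\<exists>f \<in> tuples A n \<rightarrow> carrier B.
      determined_by_oddsupp A n B f \<and> \<not> decomposable A n B f"
    by blast
qed

end
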